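(* Let $u=u_0u_1\dots u_{k-1}$ be a word over $\Sigma$ with $u_0=0$ and $k\ge2$. Then for all $n\ge0$, $$\mathrm{K}(u)(n)=\sum_{i=0}^{k-1}|(n)_k|_i\cdot u_i,$$ where $(n)_k$ is the base-$k$ expansion of $n$ and $|(n)_k|_i$ the number of occurrences of the digit $i$ in it.
   Context: $\Sigma$ is a fixed finite cyclic (additive) group; $j\cdot c$ denotes $c+\dots+c$ ($j$ times). Keane product: $u\times\varepsilon=\varepsilon$, $u\times(av)=(u+a)(u\times v)$, where $u+a$ adds $a$ to each letter of $u$; $u^{\times0}=0$, $u^{\times(n+1)}=u\times u^{\times n}$; $\mathrm{K}(u)=\lim_n u^{\times n}$, an infinite word indexed from $0$. *)

theory Defs
  imports Complex_Main
begin

definition nat_mult :: "nat \<Rightarrow> 'a::monoid_add \<Rightarrow> 'a"  (infixr "\<cdot>" 75)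
  where "j \<cdot> c = sum_list (replicate j c)"

text \<open>The group \<open>\<Sigma>\<close> is a type; being cyclic is a property of the type, hence the
  \<open>itself\<close> argument.\<close>

definition cyclic_add :: "'a::ab_group_add itself \<Rightarrow> bool"
  where "cyclic_add _ \<longleftrightarrow>
    (\<exists>g::'a. \<forall>x. \<exists>j. x = j \<cdot> g \<or> x = - (j \<cdot> g))"

fun keane_prod :: "'a::ab_group_add list \<Rightarrow> 'a list \<Rightarrow> 'a list"
  where
    "keane_prod u [] = []"
  | "keane_prod u (a # v) = map (\<lambda>b. b + a) u @ keane_prod u v"

primrec keane_pow :: "'a::ab_group_add list \<Rightarrow> nat \<Rightarrow> 'a list"
  where
    "keane_pow u 0 = [0]"
  | "keane_pow u (Suc n) = keane_prod u (keane_pow u n)"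

text \<open>Convergence of finite words to an infinite word: every position is eventually present and
  eventually carries the letter of the limit.\<close>

definition words_converge :: "(nat \<Rightarrow> 'a list) \<Rightarrow> (nat \<Rightarrow> 'a) \<Rightarrow> bool"
  where "words_converge s w \<longleftrightarrow>
    (\<forall>i. \<exists>N. \<forall>n\<ge>N. i < length (s n) \<and> s n ! i = w i)"

definition keane_word :: "'a::ab_group_add list \<Rightarrow> nat \<Rightarrow> 'a"
  where "keane_word u = (THE w. words_converge (keane_pow u) w)"

text \<open>Base-\<open>k\<close> expansion, most significant digit first, without leading zeros; the expansion of
  \<open>0\<close> is the empty word. Bases below 2 are not meaningful and yield the empty word.\<close>

fun base_expansion :: "nat \<Rightarrow> nat \<Rightarrow> nat list"
  where "base_expansion k n =
    (if k < 2 \<or> n = 0 then [] else base_expansion k (n div k) @ [n mod k])"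

declare base_expansion.simps [simp del]

lemma base_expansion_value:
  assumes "k \<ge> 2"
  shows "horner_sum (\<lambda>d. d) k (rev (base_expansion k n)) = n"
  using assms
proof (induction k n rule: base_expansion.induct)
  case (1 k n)
  then show ?case
    by (subst base_expansion.simps) (auto simp: mod_mult_div_eq)
qed

lemma base_expansion_digits:
  assumes "k \<ge> 2" and "d \<in> set (base_expansion k n)"
  shows "d < k"
  using assms
proof (induction k n rule: base_expansion.induct)
  case (1 k n)
  from "1.prems" have "n \<noteq> 0"
    by (cases "n = 0") (auto simp: base_expansion.simps[of k 0])
  with "1.prems" have "d \<in> set (base_expansion k (n div k)) \<or> d = n mod k"
    by (auto simp: base_expansion.simps[of k n])
  with "1.IH" "1.prems"(1) \<open>n \<noteq> 0\<close> show ?case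
    by auto
qed

lemma base_expansion_hd:
  assumes "k \<ge> 2" and "n > 0"
  shows "base_expansion k n \<noteq> [] \<and> hd (base_expansion k n) \<noteq> 0"
  using assms
proof (induction k n rule: base_expansion.induct)
  case (1 k n)
  show ?case
  proof (cases "n < k")
    case True
    with "1.prems" show ?thesis
      by (simp add: base_expansion.simps[of k n] base_expansion.simps[of k 0])
  next
    case False
    then have "n div k > 0"
      using "1.prems" by (simp add: div_greater_zero_iff)
    with "1.IH" "1.prems" have "base_expansion k (n div k) \<noteq> [] \<and> hd (base_expansion k (n div k)) \<noteq> 0"
      by auto
    with "1.prems" show ?thesis
      by (simp add: base_expansion.simps[of k n])
  qed
qed

end

(* Letter i of u \<times> v is u (i mod k) + v (i div k), so each further factor u of the power strips
   the last base-k digit d of the position and adds the letter u d. Since u 0 = 0, leading zeros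
   contribute nothing, and all sufficiently high powers agree at a given position. *)

theory Submission
  imports Defs
begin

lemma nat_mult_add_left: "(i + j) \<cdot> c = i \<cdot> c + j \<cdot> c"
  by (simp add: nat_mult_def replicate_add)

lemma length_keane_prod: "length (keane_prod u v) = length u * length v"
  by (induction u v rule: keane_prod.induct) auto

text \<open>The product is a concatenation of blocks of length \<open>length u\<close>, one shifted
  copy of \<open>u\<close> per letter of \<open>v\<close>: the quotient selects the block, the
  remainder the place in it.\<close>

lemma nth_keane_prod:
  assumes "i < length u * length v"
  shows "keane_prod u v ! i = u ! (i mod length u) + v ! (i div length u)"
  using assms
proof (induction u v arbitrary: i rule: keane_prod.induct)
  case (1 u)
  then show ?case by simp
next
  case (2 u a v)
  show ?case
  proof (cases "i < length u")
    case True
    then show ?thesis by (simp add: nth_append)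
  next
    \<comment> \<open>Dropping the first block lowers the quotient by one and keeps the
      remainder.\<close>
    case False
    moreover from "2.prems" have "length u > 0" by (cases u) auto
    ultimately show ?thesis
      using "2.IH"[of "i - length u"] "2.prems"
      by (simp add: nth_append le_mod_geq le_div_geq)
  qed
qed

lemma length_keane_pow: "length (keane_pow u m) = length u ^ m"
  by (induction m) (simp_all add: length_keane_prod)

text \<open>Needed because \<open>keane_word\<close> is a definite description.\<close>

lemma words_converge_unique:
  assumes "words_converge s w" and "words_converge s w'"
  shows "w = w'"
proof
  fix i
  from assms obtain N N' where "\<forall>n\<ge>N. s n ! i = w i" and "\<forall>n\<ge>N'. s n ! i = w' i"
    unfolding words_converge_def by meson
  then show "w i = w' i"
    by (metis max.cobounded1 max.cobounded2)
qed

definition digit_sum :: "'a::ab_group_add list \<Rightarrow> nat \<Rightarrow> 'a"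
  where "digit_sum u n =
    (\<Sum>i<length u. count_list (base_expansion (length u) n) i \<cdot> (u ! i))"

lemma digit_sum_0: "digit_sum u 0 = 0"
  by (simp add: digit_sum_def base_expansion.simps nat_mult_def)

text \<open>For \<open>n > 0\<close> the expansion of \<open>n\<close> is that of the quotient
  followed by the remainder. For \<open>n = 0\<close> it is empty, and \<open>u ! 0 = 0\<close>
  rescues the equation.\<close>

lemma digit_sum_rec:
  assumes "length u \<ge> 2" and "u ! 0 = 0"
  shows "digit_sum u n = u ! (n mod length u) + digit_sum u (n div length u)"
proof (cases "n = 0")
  case True
  with assms show ?thesis by (simp add: digit_sum_0)
next
  case False
  let ?k = "length u"
  \<comment> \<open>The one-digit count acts as a Kronecker delta, so its sum over \<open>i\<close>
    collapses to \<open>u ! d\<close> once \<open>d < length u\<close>.\<close>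
  have last_digit: "count_list [d] i \<cdot> (u ! i) = (if i = d then u ! i else 0)" for d i
    by (simp add: nat_mult_def)
  have "base_expansion ?k n = base_expansion ?k (n div ?k) @ [n mod ?k]"
    using False assms by (simp add: base_expansion.simps[of ?k n])
  moreover have "n mod ?k < ?k"
    using assms by (intro mod_less_divisor) linarith
  ultimately show ?thesis
    by (simp add: digit_sum_def nat_mult_add_left sum.distrib last_digit add.commute
        del: count_list.simps)
qed

text \<open>Both sides obey the same recursion, which moves from \<open>i\<close> to
  \<open>i div length u\<close>; hence the induction generalizes over \<open>i\<close>.\<close>

lemma nth_keane_pow:
  assumes "length u \<ge> 2" and "u ! 0 = 0" and "i < length u ^ m"
  shows "keane_pow u m ! i = digit_sum u i"
  using assms(3)
proof (induction m arbitrary: i)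
  case 0
  then show ?case by (simp add: digit_sum_0)
next
  case (Suc m)
  then have "i div length u < length u ^ m"
    by (simp add: less_mult_imp_div_less mult.commute)
  with Suc show ?case
    by (simp add: nth_keane_prod length_keane_pow digit_sum_rec[OF assms(1,2), of i])
qed

lemma words_converge_keane_pow:
  assumes "length u \<ge> 2" and "u ! 0 = 0"
  shows "words_converge (keane_pow u) (digit_sum u)"
  unfolding words_converge_def
proof (intro allI exI impI)
  fix i m :: nat
  \<comment> \<open>This fixes the threshold as \<open>i\<close> itself, since
    \<open>m < length u ^ m\<close> puts position \<open>i\<close> inside every later power.\<close>
  assume "i \<le> m"
  also have "m < length u ^ m"
    using assms(1) by (intro power_gt_expt) auto
  finally show "i < length (keane_pow u m) \<and> keane_pow u m ! i = digit_sum u i"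
    using assms by (simp add: length_keane_pow nth_keane_pow)
qed

lemma keane_word_eq_digit_sum:
  assumes "length u \<ge> 2" and "u ! 0 = 0"
  shows "keane_word u = digit_sum u"
  unfolding keane_word_def
  by (rule the_equality) (rule words_converge_keane_pow[OF assms],
      rule words_converge_unique[OF _ words_converge_keane_pow[OF assms]])

theorem mainTheorem5:
  fixes u :: "'a::{ab_group_add,finite} list" and k n :: nat
  assumes "cyclic_add TYPE('a)"
    and "length u = k"
    and "k \<ge> 2"
    and "u ! 0 = 0"
  shows "keane_word u n = (\<Sum>i=0..k-1. count_list (base_expansion k n) i \<cdot> (u ! i))"
proof -
  \<comment> \<open>The subtraction is truncated, so \<open>k\<close> must be positive here.\<close>
  have "{0..k-1} = {..<k}" using \<open>k \<ge> 2\<close> by auto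
  then show ?thesis
    using assms by (simp add: keane_word_eq_digit_sum digit_sum_def)
qed

end
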